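(* Let $A=\Bbbk\mathcal{Q}/\mathcal{I}$ be a gentle or locally gentle algebra, and for $n\ge 1$ suppose that $A$ has $k_n$ finite maximal paths of length at least $n$. Then the Hilbert series $h_A(t)=\sum_{n\ge0}\dim_\Bbbk(A_n)t^n$ of $A$ is $$h_A(t)=\frac{|\mathcal{Q}_0|+(|\mathcal{Q}_1|-|\mathcal{Q}_0|)t-\sum_{n\ge1}k_nt^{n+1}}{1-t}.$$
   Context: $\Bbbk$ is a field of characteristic $0$. A quiver $\mathcal{Q}=(\mathcal{Q}_0,\mathcal{Q}_1,s,t)$ has vertex set $\mathcal{Q}_0$, arrow set $\mathcal{Q}_1$, source and target maps $s,t$; all quivers are finite and connected with $|\mathcal{Q}_0|,|\mathcal{Q}_1|\ge 1$. $\operatorname{indeg}(v)$, $\operatorname{outdeg}(v)$ are the numbers of arrows with target, respectively source, $v$. Paths are composed left to right; $\Bbbk\mathcal{Q}$ is the path algebra. $A=\Bbbk\mathcal{Q}/\mathcal{I}$ is gentle if: (i) $\operatorname{indeg}(v),\operatorname{outdeg}(v)\le 2$ for all $v$; (ii) whenever $s(\alpha)=t(\beta)=t(\beta')$ with $\beta\ne\beta'$ arrows, exactly one of $\beta\alpha,\beta'\alpha$ is in $\mathcal{I}$; (iii) whenever $t(\alpha)=s(\beta)=s(\beta')$ with $\beta\neq\beta'$, exactly one of $\alpha\beta,\alpha\beta'$ is in $\mathcal{I}$; (iv) $\mathcal{I}$ is generated by paths of length $2$; (v) $A$ is finite dimensional. It is locally gentle if it satisfies (i)-(iv) and is infinite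 dimensional. $A=\bigoplus_{n\ge0}A_n$ is graded by path length. A path $p\notin\mathcal{I}$ is a finite maximal path if $p\alpha\in\mathcal{I}$ and $\alpha p\in\mathcal{I}$ for every arrow $\alpha$. *)

theory Defs
  imports
    "HOL-Computational_Algebra.Formal_Power_Series"
    "HOL-Library.Poly_Mapping"
    "HOL-Algebra.QuotRing"
    "HOL-Algebra.Embedded_Algebras"
    "Graph_Theory.Graph_Theory"
begin

text \<open>
  A quiver is a finite connected multidigraph in the sense of \<open>Graph_Theory\<close>, where
  \<open>tail\<close> is the source map and \<open>head\<close> the target map. Here \<open>connected\<close> refers to the
  underlying undirected graph.
\<close>

definition quiver :: "('v, 'e) pre_digraph \<Rightarrow> bool" where
  "quiver Q \<longleftrightarrow> fin_digraph Q \<and> Digraph_Component.connected Q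
     \<and> card (verts Q) \<ge> 1 \<and> card (arcs Q) \<ge> 1"

text \<open>
  A path is its start vertex together with its list of arrows, read from left to right; the start
  vertex is what distinguishes the trivial paths \<open>(v, [])\<close> from each other.
\<close>

type_synonym ('v, 'e) path = "'v \<times> 'e list"

definition paths :: "('v, 'e) pre_digraph \<Rightarrow> ('v, 'e) path set" where
  "paths Q = {(v, es). \<exists>w. pre_digraph.awalk Q v es w}"

abbreviation path_source :: "('v, 'e) path \<Rightarrow> 'v" where
  "path_source p \<equiv> fst p"

definition path_target :: "('v, 'e) pre_digraph \<Rightarrow> ('v, 'e) path \<Rightarrow> 'v" where
  "path_target Q p = pre_digraph.awlast Q (fst p) (snd p)"

abbreviation path_length :: "('v, 'e) path \<Rightarrow> nat" where
  "path_length p \<equiv> length (snd p)"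

definition path_concat :: "('v, 'e) path \<Rightarrow> ('v, 'e) path \<Rightarrow> ('v, 'e) path" where
  "path_concat p q = (fst p, snd p @ snd q)"


definition path_mult ::
  "('v, 'e) pre_digraph \<Rightarrow> (('v, 'e) path \<Rightarrow>\<^sub>0 'k) \<Rightarrow> (('v, 'e) path \<Rightarrow>\<^sub>0 'k)
    \<Rightarrow> (('v, 'e) path \<Rightarrow>\<^sub>0 'k::field)" where
  "path_mult Q f g =
     (\<Sum>p\<in>Poly_Mapping.keys f. \<Sum>q\<in>Poly_Mapping.keys g.
        if path_target Q p = path_source q
        then Poly_Mapping.single (path_concat p q) (Poly_Mapping.lookup f p * Poly_Mapping.lookup g q)
        else 0)"

definition path_algebra :: "('v, 'e) pre_digraph \<Rightarrow> (('v, 'e) path \<Rightarrow>\<^sub>0 'k::field) ring" where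
  "path_algebra Q =
     \<lparr>carrier = {f. Poly_Mapping.keys f \<subseteq> paths Q},
      mult = path_mult Q,
      one = (\<Sum>v\<in>verts Q. Poly_Mapping.single (v, []) 1),
      zero = 0,
      add = (+)\<rparr>"

abbreviation path_elem :: "('v, 'e) path \<Rightarrow> (('v, 'e) path \<Rightarrow>\<^sub>0 'k::field)" where
  "path_elem p \<equiv> Poly_Mapping.single p 1"

definition arrow :: "('v, 'e) pre_digraph \<Rightarrow> 'e \<Rightarrow> (('v, 'e) path \<Rightarrow>\<^sub>0 'k::field)" where
  "arrow Q \<alpha> = path_elem (tail Q \<alpha>, [\<alpha>])"

definition quotient_algebra ::
  "('v, 'e) pre_digraph \<Rightarrow> (('v, 'e) path \<Rightarrow>\<^sub>0 'k::field) set \<Rightarrow> (('v, 'e) path \<Rightarrow>\<^sub>0 'k) set ring" where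
  "quotient_algebra Q I = path_algebra Q Quot I"

text \<open>
  Dimensions over \<open>'k\<close> are those of \<open>ring.dim\<close>, the dimension over a subfield of a ring.
  For this the coefficient field is identified with its image \<open>{c \<cdot> 1 + I}\<close> in the quotient;
  multiplication by \<open>c \<cdot> 1\<close> is scalar multiplication by \<open>c\<close>.
\<close>

definition scalars ::
  "('v, 'e) pre_digraph \<Rightarrow> (('v, 'e) path \<Rightarrow>\<^sub>0 'k::field) set \<Rightarrow> (('v, 'e) path \<Rightarrow>\<^sub>0 'k) set set" where
  "scalars Q I =
     {I +>\<^bsub>path_algebra Q\<^esub> (\<Sum>v\<in>verts Q. Poly_Mapping.single (v, []) c) | c. True}"

definition graded_part ::
  "('v, 'e) pre_digraph \<Rightarrow> (('v, 'e) path \<Rightarrow>\<^sub>0 'k::field) set \<Rightarrow> nat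
    \<Rightarrow> (('v, 'e) path \<Rightarrow>\<^sub>0 'k) set set" where
  "graded_part Q I n =
     {I +>\<^bsub>path_algebra Q\<^esub> f | f. Poly_Mapping.keys f \<subseteq> {p \<in> paths Q. path_length p = n}}"

definition hilbert_series ::
  "('v, 'e) pre_digraph \<Rightarrow> (('v, 'e) path \<Rightarrow>\<^sub>0 'k::field) set \<Rightarrow> rat fps" where
  "hilbert_series Q I =
     Abs_fps (\<lambda>n. of_nat (ring.dim (quotient_algebra Q I) (scalars Q I) (graded_part Q I n)))"

text \<open>
  The conditions common to gentle and locally gentle algebras. They are stated for the pair
  \<open>(Q, I)\<close>; the algebra itself is \<^term>\<open>quotient_algebra Q I\<close>.
\<close>

definition gentle_relations ::
  "('v, 'e) pre_digraph \<Rightarrow> (('v, 'e) path \<Rightarrow>\<^sub>0 'k::field) set \<Rightarrow> bool" where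
  "gentle_relations Q I \<longleftrightarrow>
     (\<forall>v\<in>verts Q. in_degree Q v \<le> 2 \<and> out_degree Q v \<le> 2) \<and>
     (\<forall>\<alpha>\<in>arcs Q. \<forall>\<beta>\<in>arcs Q. \<forall>\<beta>'\<in>arcs Q.
        \<beta> \<noteq> \<beta>' \<and> tail Q \<alpha> = head Q \<beta> \<and> tail Q \<alpha> = head Q \<beta>' \<longrightarrow>
        (arrow Q \<beta> \<otimes>\<^bsub>path_algebra Q\<^esub> arrow Q \<alpha> \<in> I) \<noteq> (arrow Q \<beta>' \<otimes>\<^bsub>path_algebra Q\<^esub> arrow Q \<alpha> \<in> I)) \<and>
     (\<forall>\<alpha>\<in>arcs Q. \<forall>\<beta>\<in>arcs Q. \<forall>\<beta>'\<in>arcs Q.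
        \<beta> \<noteq> \<beta>' \<and> head Q \<alpha> = tail Q \<beta> \<and> head Q \<alpha> = tail Q \<beta>' \<longrightarrow>
        (arrow Q \<alpha> \<otimes>\<^bsub>path_algebra Q\<^esub> arrow Q \<beta> \<in> I) \<noteq> (arrow Q \<alpha> \<otimes>\<^bsub>path_algebra Q\<^esub> arrow Q \<beta>' \<in> I)) \<and>
     (\<exists>R \<subseteq> {p \<in> paths Q. path_length p = 2}. I = Idl\<^bsub>path_algebra Q\<^esub> (path_elem ` R))"

definition finite_dimensional ::
  "('v, 'e) pre_digraph \<Rightarrow> (('v, 'e) path \<Rightarrow>\<^sub>0 'k::field) set \<Rightarrow> bool" where
  "finite_dimensional Q I \<longleftrightarrow>
     ring.finite_dimension (quotient_algebra Q I) (scalars Q I) (carrier (quotient_algebra Q I))"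

definition gentle :: "('v, 'e) pre_digraph \<Rightarrow> (('v, 'e) path \<Rightarrow>\<^sub>0 'k::field) set \<Rightarrow> bool" where
  "gentle Q I \<longleftrightarrow> gentle_relations Q I \<and> finite_dimensional Q I"

definition locally_gentle :: "('v, 'e) pre_digraph \<Rightarrow> (('v, 'e) path \<Rightarrow>\<^sub>0 'k::field) set \<Rightarrow> bool" where
  "locally_gentle Q I \<longleftrightarrow> gentle_relations Q I \<and> \<not> finite_dimensional Q I"

definition finite_maximal_path ::
  "('v, 'e) pre_digraph \<Rightarrow> (('v, 'e) path \<Rightarrow>\<^sub>0 'k::field) set \<Rightarrow> ('v, 'e) path \<Rightarrow> bool" where
  "finite_maximal_path Q I p \<longleftrightarrow>
     p \<in> paths Q \<and> path_elem p \<notin> I \<and>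
     (\<forall>\<alpha>\<in>arcs Q. path_elem p \<otimes>\<^bsub>path_algebra Q\<^esub> arrow Q \<alpha> \<in> I \<and>
                  arrow Q \<alpha> \<otimes>\<^bsub>path_algebra Q\<^esub> path_elem p \<in> I)"

end

theory Submission
  imports Defs
begin

text \<open>
  The ideal is spanned by the paths containing a relation, so the remaining nonzero paths of length
  \<open>n\<close> form a basis of \<open>A\<^sub>n\<close>. A nonzero path of positive length is a chain for the relation
  ``the product of the arrows \<open>a\<close> and \<open>b\<close> is nonzero'', which the gentle conditions make a partial
  injection on the finite set of arrows. Hence \<open>dim A\<^sub>n - dim A\<^sub>n\<^sub>+\<^sub>1\<close> counts the nonzero paths of
  length \<open>n\<close> that cannot be prolonged on the right. Such a path contains no repeated arrow, so
  its unique prolongation to the left stops; this matches it with the finite maximal path of length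
  at least \<open>n\<close> of which it is the final segment.
\<close>

section \<open>Chains of a partial injection\<close>

text \<open>Containing a relation is a statement about factorisations of an arrow list. This form of
  \<open>successively\<close> makes it comparable with the chain condition.\<close>

lemma successively_iff_adjacent:
  "successively P xs \<longleftrightarrow> (\<forall>us a b ws. xs = us @ a # b # ws \<longrightarrow> P a b)"
proof
  show "successively P xs \<Longrightarrow> \<forall>us a b ws. xs = us @ a # b # ws \<longrightarrow> P a b"
    by (auto simp: successively_append_iff)
next
  show "\<forall>us a b ws. xs = us @ a # b # ws \<longrightarrow> P a b \<Longrightarrow> successively P xs"
  proof (induction xs)
    case (Cons x xs)
    have "successively P xs" using Cons.prems by (intro Cons.IH) (metis append_Cons)
    moreover have "xs = [] \<or> P x (hd xs)"
      using Cons.prems by (metis append_Nil list.collapse)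
    ultimately show ?case by (simp add: successively_Cons)
  qed simp
qed

text \<open>Separates the counting from the algebra: \<open>E\<close> will be the set of arrows and
  \<open>N\<close> the relation \<open>follows\<close>.\<close>

locale finite_partial_injection =
  fixes E :: "'a set" and N :: "'a \<Rightarrow> 'a \<Rightarrow> bool"
  assumes finite_E: "finite E"
    and N_in_E: "N a b \<Longrightarrow> a \<in> E \<and> b \<in> E"
    and N_functional: "N a b \<Longrightarrow> N a c \<Longrightarrow> b = c"
    and N_injective: "N a c \<Longrightarrow> N b c \<Longrightarrow> a = b"
begin

definition chains :: "nat \<Rightarrow> 'a list set" where
  "chains n = {xs. set xs \<subseteq> E \<and> successively N xs \<and> length xs = n}"

text \<open>Meant for \<open>n \<ge> 1\<close>: then every member is nonempty, and \<open>hd\<close>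
  and \<open>last\<close> have their proper meaning.\<close>

definition maximal_chains :: "nat \<Rightarrow> 'a list set" where
  "maximal_chains n = {xs. set xs \<subseteq> E \<and> successively N xs \<and> n \<le> length xs
     \<and> (\<forall>a. \<not> N (last xs) a \<and> \<not> N a (hd xs))}"

lemma finite_chains: "finite (chains n)"
proof -
  have "chains n \<subseteq> {xs. set xs \<subseteq> E \<and> length xs = n}"
    by (auto simp: chains_def)
  then show ?thesis
    using finite_lists_length_eq[OF finite_E] finite_subset by blast
qed

text \<open>A repetition in a chain would propagate to the right up to the last element and give it a
  successor.\<close>

lemma distinct_of_terminal:
  assumes "successively N xs" and "\<And>a. \<not> N (last xs) a"
  shows "distinct xs"
proof -
  have step: "N (xs ! i) (xs ! Suc i)" if "Suc i < length xs" for i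
    using assms(1) that by (simp add: successively_conv_nth)
  have False if "i < j" "j < length xs" "xs ! i = xs ! j" for i j
  proof -
    have shift: "j + d < length xs \<Longrightarrow> xs ! (i + d) = xs ! (j + d)" for d
    proof (induction d)
      case (Suc d)
      have "N (xs ! (i + d)) (xs ! Suc (i + d))" "N (xs ! (j + d)) (xs ! Suc (j + d))"
        using \<open>i < j\<close> Suc.prems by (intro step; simp)+
      moreover have "xs ! (i + d) = xs ! (j + d)" using Suc by simp
      ultimately show ?case using N_functional by simp
    qed (use that in simp)
    \<comment> \<open>\<open>d\<close> shifts \<open>j\<close> to the last position. Position
      \<open>i + d\<close> then holds the same element but lies strictly before the end, so that
      element has a successor.\<close>
    define d where "d = length xs - 1 - j"
    have "xs ! (i + d) = last xs"
      using shift[of d] that last_conv_nth[of xs] by (cases "xs = []") (auto simp: d_def)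
    moreover have "N (xs ! (i + d)) (xs ! Suc (i + d))"
      using that by (intro step) (auto simp: d_def)
    ultimately show False using assms(2) by metis
  qed
  then show ?thesis by (metis distinct_conv_nth nat_neq_iff)
qed

text \<open>By injectivity each element has at most one predecessor, so the two prefixes agree when
  read from right to left. Neither can stop before the other, because a list stops only where no
  predecessor exists.\<close>

lemma left_extension_unique:
  assumes "successively N (xs @ zs)" "\<And>a. \<not> N a (hd (xs @ zs))"
    and "successively N (ys @ zs)" "\<And>a. \<not> N a (hd (ys @ zs))"
    and "zs \<noteq> []"
  shows "xs = ys"
  using assms
proof (induction xs arbitrary: ys zs rule: rev_induct)
  case Nil
  show ?case
  proof (rule ccontr)
    assume "[] \<noteq> ys"
    then have "N (last ys) (hd zs)" using Nil by (simp add: successively_append_iff)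
    with Nil show False by simp
  qed
next
  case (snoc x xs)
  have x: "N x (hd zs)" using snoc.prems by (simp add: successively_append_iff successively_Cons)
  show ?case
  proof (cases ys rule: rev_cases)
    case Nil
    then show ?thesis using x snoc.prems by simp
  next
    case (snoc vs y)
    then have "N y (hd zs)"
      using snoc.prems by (simp add: successively_append_iff successively_Cons)
    with x have "x = y" by (rule N_injective)
    \<comment> \<open>The common last element of both prefixes is moved into the shared suffix,
      where the induction hypothesis applies.\<close>
    then show ?thesis
      using snoc.IH[of "x # zs" vs] snoc.prems snoc by simp
  qed
qed

text \<open>Every chain ending in \<open>zs\<close> is terminal and hence distinct, so the prefixes
  have length at most \<open>card E\<close>. A longest prefix has no predecessor.\<close>

lemma left_extension_exists:
  assumes "set zs \<subseteq> E" "successively N zs" "zs \<noteq> []" "\<And>a. \<not> N (last zs) a"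
  obtains xs where "set (xs @ zs) \<subseteq> E" "successively N (xs @ zs)" "\<And>a. \<not> N a (hd (xs @ zs))"
proof -
  let ?P = "\<lambda>xs. set (xs @ zs) \<subseteq> E \<and> successively N (xs @ zs)"
  have bound: "length xs \<le> card E" if "?P xs" for xs
  proof -
    have "distinct (xs @ zs)"
      using that assms by (intro distinct_of_terminal) auto
    then have "distinct xs" by simp
    then have "length xs = card (set xs)" by (simp add: distinct_card)
    also have "\<dots> \<le> card E" using that finite_E by (intro card_mono) auto
    finally show ?thesis .
  qed
  have "?P []" using assms by simp
  with bound obtain xs where xs: "?P xs" and max: "\<And>ys. ?P ys \<Longrightarrow> length ys \<le> length xs"
    using ex_has_greatest_nat[of ?P "[]" length "Suc (card E)"] by (metis le_imp_less_Suc)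
  have "\<not> N a (hd (xs @ zs))" for a
  proof
    assume "N a (hd (xs @ zs))"
    then have "?P (a # xs)"
      using xs N_in_E assms(3) by (cases "xs @ zs") auto
    from max[OF this] show False by simp
  qed
  with xs that show thesis by blast
qed

text \<open>The chains of length \<open>n\<close> split into those with a successor
  (\<open>U\<close>) and the terminal ones (\<open>T\<close>). The former are counted by the chains
  of length \<open>Suc n\<close>, the latter by the maximal chains.\<close>

lemma card_chains:
  assumes "n \<ge> 1"
  shows "card (chains n) = card (chains (Suc n)) + card (maximal_chains n)"
proof -
  define T where "T = {xs \<in> chains n. \<forall>a. \<not> N (last xs) a}"
  define U where "U = {xs \<in> chains n. \<exists>a. N (last xs) a}"
  have ne: "xs \<noteq> []" if "xs \<in> chains n" for xs using that assms by (auto simp: chains_def)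
  \<comment> \<open>The deleted element is recovered as the unique successor of the new last
    element; this uses that \<open>butlast\<close> leaves a nonempty list.\<close>
  have "bij_betw butlast (chains (Suc n)) U"
  proof (rule bij_betw_imageI)
    show "inj_on butlast (chains (Suc n))"
    proof (rule inj_onI)
      fix xs ys assume xs: "xs \<in> chains (Suc n)" and ys: "ys \<in> chains (Suc n)"
        and eq: "butlast xs = butlast ys"
      obtain us x where us: "xs = us @ [x]" using xs by (cases xs rule: rev_cases) (auto simp: chains_def)
      obtain vs y where vs: "ys = vs @ [y]" using ys by (cases ys rule: rev_cases) (auto simp: chains_def)
      have "us = vs" "us \<noteq> []" using eq us vs xs assms by (auto simp: chains_def)
      then have "N (last us) x" "N (last us) y"
        using xs ys us vs by (auto simp: chains_def successively_append_iff)
      then show "xs = ys" using us vs \<open>us = vs\<close> N_functional by blast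
    qed
    show "butlast ` chains (Suc n) = U"
    proof (intro equalityI subsetI)
      fix ys assume "ys \<in> butlast ` chains (Suc n)"
      then obtain xs where xs: "xs \<in> chains (Suc n)" "ys = butlast xs" by blast
      then obtain x where x: "xs = ys @ [x]"
        by (cases xs rule: rev_cases) (auto simp: chains_def)
      then have "ys \<noteq> []" "ys @ [x] \<in> chains (Suc n)" using xs(1) assms by (auto simp: chains_def)
      then show "ys \<in> U" by (auto simp: U_def chains_def successively_append_iff)
    next
      fix ys assume "ys \<in> U"
      then obtain a where ys: "ys \<in> chains n" "N (last ys) a" by (auto simp: U_def)
      then have "ys @ [a] \<in> chains (Suc n)"
        using N_in_E by (auto simp: chains_def successively_append_iff)
      then show "ys \<in> butlast ` chains (Suc n)" by force
    qed
  qed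
  then have U: "card U = card (chains (Suc n))" by (simp add: bij_betw_same_card)
  \<comment> \<open>\<open>?f\<close> keeps the last \<open>n\<close> elements. Uniqueness of left
    extensions gives injectivity, their existence gives surjectivity onto \<open>T\<close>.\<close>
  let ?f = "\<lambda>xs. drop (length xs - n) xs"
  have "bij_betw ?f (maximal_chains n) T"
  proof (rule bij_betw_imageI)
    show "inj_on ?f (maximal_chains n)"
    proof (rule inj_onI)
      fix xs ys assume xs: "xs \<in> maximal_chains n" and ys: "ys \<in> maximal_chains n"
        and eq: "?f xs = ?f ys"
      define zs where "zs = ?f xs"
      define us where "us = take (length xs - n) xs"
      define vs where "vs = take (length ys - n) ys"
      have x: "xs = us @ zs" by (simp add: us_def zs_def)
      have y: "ys = vs @ zs" unfolding zs_def eq by (simp add: vs_def)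
      have "zs \<noteq> []" using xs assms by (auto simp: zs_def maximal_chains_def)
      then have "us = vs"
        using xs ys by (intro left_extension_unique[of us zs vs]) (simp_all add: x[symmetric] y[symmetric] maximal_chains_def)
      then show "xs = ys" using x y by simp
    qed
    show "?f ` maximal_chains n = T"
    proof (intro equalityI subsetI)
      fix ys assume "ys \<in> ?f ` maximal_chains n"
      then obtain xs where xs: "xs \<in> maximal_chains n" "ys = ?f xs" by blast
      have "successively N (take (length xs - n) xs @ ys)"
        using xs by (simp add: maximal_chains_def)
      then have "successively N ys" by (simp only: successively_append_iff)
      then show "ys \<in> T"
        using xs assms by (auto simp: T_def chains_def maximal_chains_def dest: in_set_dropD)
    next
      fix ys assume ys: "ys \<in> T"
      then obtain xs where xs: "set (xs @ ys) \<subseteq> E" "successively N (xs @ ys)"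
        "\<And>a. \<not> N a (hd (xs @ ys))"
        using left_extension_exists[of ys] ne[of ys] by (auto simp: T_def chains_def)
      then have "xs @ ys \<in> maximal_chains n"
        using ys ne[of ys] by (auto simp: maximal_chains_def T_def chains_def)
      moreover have "?f (xs @ ys) = ys" using ys by (auto simp: T_def chains_def)
      ultimately show "ys \<in> ?f ` maximal_chains n" by (rule rev_image_eqI[OF _ sym])
    qed
  qed
  then have T: "card T = card (maximal_chains n)" by (simp add: bij_betw_same_card)
  have "chains n = U \<union> T" "U \<inter> T = {}" by (auto simp: U_def T_def)
  then show ?thesis
    using card_Un_disjoint[of U T] finite_chains[of n] U T by simp
qed

end

section \<open>The path algebra\<close>

abbreviation (input) single where "single \<equiv> Poly_Mapping.single"
abbreviation (input) keys where "keys \<equiv> Poly_Mapping.keys"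
abbreviation (input) lookup where "lookup \<equiv> Poly_Mapping.lookup"

section \<open>Finitely supported functions as sums of monomials\<close>

lemma sum_single_lookup:
  fixes f :: "'a \<Rightarrow>\<^sub>0 'b::comm_monoid_add"
  shows "(\<Sum>p\<in>keys f. single p (lookup f p)) = f"
proof (rule poly_mapping_eqI)
  fix q
  have "lookup (\<Sum>p\<in>keys f. single p (lookup f p)) q = (\<Sum>p\<in>keys f. if p = q then lookup f p else 0)"
    by (simp add: lookup_sum lookup_single when_def)
  also have "\<dots> = lookup f q" by (simp add: in_keys_iff)
  finally show "lookup (\<Sum>p\<in>keys f. single p (lookup f p)) q = lookup f q" .
qed

text \<open>A finitely supported function is the sum of its terms. The rule reduces claims that are
  stable under addition to single paths, while keeping the support in \<open>S\<close>.\<close>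

lemma poly_mapping_keys_induct [consumes 1, case_names zero single add]:
  fixes f :: "'a \<Rightarrow>\<^sub>0 'b::comm_monoid_add"
  assumes "keys f \<subseteq> S"
    and "P 0" and "\<And>p c. p \<in> S \<Longrightarrow> P (single p c)"
    and "\<And>f g. P f \<Longrightarrow> P g \<Longrightarrow> P (f + g)"
  shows "P f"
proof -
  have "P (\<Sum>p\<in>A. single p (lookup f p))" if "A \<subseteq> keys f" for A
    using finite_subset[OF that finite_keys] that
    by (induction A rule: finite_induct) (use assms in auto)
  then show ?thesis using sum_single_lookup[of f] by (metis order_refl)
qed

lemmas poly_mapping_single_induct =
  poly_mapping_keys_induct[OF subset_UNIV, consumes 0, case_names zero single add]

section \<open>The product of the path algebra\<close>

lemma path_target_conv: "path_target Q p = (if snd p = [] then fst p else head Q (last (snd p)))"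
  by (simp add: path_target_def pre_digraph.awalk_verts_conv)

lemma path_target_concat:
  "path_target Q p = fst q \<Longrightarrow> path_target Q (path_concat p q) = path_target Q q"
  by (auto simp: path_target_conv path_concat_def)

lemma path_mult_single:
  "path_mult Q (single p a) (single q b) =
    (if path_target Q p = fst q then single (path_concat p q) (a * b) else 0)"
  by (auto simp: path_mult_def)

text \<open>Terms outside the supports have coefficient zero. Products of functions with different
  supports can thus be written over a common index set, as additivity requires.\<close>

lemma path_mult_superset:
  assumes "finite A" "keys f \<subseteq> A" "finite B" "keys g \<subseteq> B"
  shows "path_mult Q f g = (\<Sum>p\<in>A. \<Sum>q\<in>B. if path_target Q p = fst q
    then single (path_concat p q) (lookup f p * lookup g q) else 0)"
proof -
  have "path_mult Q f g = (\<Sum>p\<in>keys f. \<Sum>q\<in>B. if path_target Q p = fst q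
    then single (path_concat p q) (lookup f p * lookup g q) else 0)"
    unfolding path_mult_def
    by (intro sum.cong refl sum.mono_neutral_left) (use assms in \<open>auto simp: in_keys_iff\<close>)
  also have "\<dots> = (\<Sum>p\<in>A. \<Sum>q\<in>B. if path_target Q p = fst q
    then single (path_concat p q) (lookup f p * lookup g q) else 0)"
    by (intro sum.mono_neutral_left) (use assms in \<open>auto simp: in_keys_iff intro!: sum.neutral\<close>)
  finally show ?thesis .
qed

lemma path_mult_add_left: "path_mult Q (f + g) h = path_mult Q f h + path_mult Q g h"
proof -
  let ?A = "keys f \<union> keys g"
  have "keys (f + g) \<subseteq> ?A" by (rule keys_add)
  then show ?thesis
    by (subst (1 2 3) path_mult_superset[of ?A _ "keys h"])
      (auto simp: sum.distrib[symmetric] lookup_add algebra_simps single_add intro!: sum.cong)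
qed

lemma path_mult_add_right: "path_mult Q h (f + g) = path_mult Q h f + path_mult Q h g"
proof -
  let ?A = "keys f \<union> keys g"
  have "keys (f + g) \<subseteq> ?A" by (rule keys_add)
  then show ?thesis
    by (subst (1 2 3) path_mult_superset[of "keys h" _ ?A])
      (auto simp: sum.distrib[symmetric] lookup_add algebra_simps single_add intro!: sum.cong)
qed

lemma path_mult_zero [simp]: "path_mult Q 0 f = 0" "path_mult Q f 0 = 0"
  by (simp_all add: path_mult_def)

lemma path_mult_sum_left: "path_mult Q (\<Sum>i\<in>A. f i) g = (\<Sum>i\<in>A. path_mult Q (f i) g)"
  by (induction A rule: infinite_finite_induct) (simp_all add: path_mult_add_left)

lemma path_mult_sum_right: "path_mult Q g (\<Sum>i\<in>A. f i) = (\<Sum>i\<in>A. path_mult Q g (f i))"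
  by (induction A rule: infinite_finite_induct) (simp_all add: path_mult_add_right)

text \<open>Additivity in each argument reduces the claim to three single paths, where it is
  associativity of list concatenation and of the field multiplication.\<close>

lemma path_mult_assoc:
  fixes f g h :: "('v, 'e) path \<Rightarrow>\<^sub>0 'k::field"
  shows "path_mult Q (path_mult Q f g) h = path_mult Q f (path_mult Q g h)"
proof (induction f rule: poly_mapping_single_induct)
  case (single p a)
  show ?case
  proof (induction g rule: poly_mapping_single_induct)
    case (single q b)
    show ?case
    proof (induction h rule: poly_mapping_single_induct)
      case (single r c)
      show ?case
        by (auto simp: path_mult_single path_target_concat) (auto simp: path_concat_def mult.assoc)
    qed (simp_all add: path_mult_add_right)
  qed (simp_all add: path_mult_add_left path_mult_add_right)
qed (simp_all add: path_mult_add_left)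

text \<open>Only an inclusion, since terms from different factorisations of one path may cancel. It
  yields closure of the carrier under products and the ideal property of
  \<open>zero_ideal\<close>.\<close>

lemma keys_path_mult:
  "keys (path_mult Q f g) \<subseteq> {path_concat p q | p q. p \<in> keys f \<and> q \<in> keys g \<and> path_target Q p = fst q}"
proof -
  have "keys (path_mult Q f g) \<subseteq> (\<Union>p\<in>keys f. \<Union>q\<in>keys g. keys (if path_target Q p = fst q
    then single (path_concat p q) (lookup f p * lookup g q) else 0))"
    unfolding path_mult_def by (intro order_trans[OF keys_sum] UN_mono order_refl)
  moreover have "keys (if path_target Q p = fst q
    then single (path_concat p q) (lookup f p * lookup g q) else 0)
      \<subseteq> {path_concat p q | p q. p \<in> keys f \<and> q \<in> keys g \<and> path_target Q p = fst q}"
    if "p \<in> keys f" "q \<in> keys g" for p q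
    using that by (auto simp del: split_paired_Ex)
  ultimately show ?thesis by blast
qed

text \<open>This is \<open>c\<close> times the identity. One name covers both the unit of the
  algebra (\<open>c = 1\<close>) and the representatives occurring in
  \<open>scalars\<close>.\<close>

definition path_scalar :: "('v, 'e) pre_digraph \<Rightarrow> 'k \<Rightarrow> (('v, 'e) path \<Rightarrow>\<^sub>0 'k::field)" where
  "path_scalar Q c = (\<Sum>v\<in>verts Q. single (v, []) c)"

text \<open>Only the trivial path at the start vertex of \<open>p\<close> composes with
  \<open>p\<close>, so a single summand survives.\<close>

lemma path_mult_scalar_left:
  assumes "finite (verts Q)" "fst p \<in> verts Q"
  shows "path_mult Q (path_scalar Q c) (single p a) = single p (c * a)"
proof -
  have "path_mult Q (path_scalar Q c) (single p a)
      = (\<Sum>v\<in>verts Q. if v = fst p then single p (c * a) else 0)"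
    unfolding path_scalar_def path_mult_sum_left
    by (intro sum.cong refl) (auto simp: path_mult_single path_target_conv path_concat_def)
  then show ?thesis using assms by simp
qed

lemma path_mult_scalar_right:
  assumes "finite (verts Q)" "path_target Q p \<in> verts Q"
  shows "path_mult Q (single p a) (path_scalar Q c) = single p (a * c)"
proof -
  have "path_mult Q (single p a) (path_scalar Q c)
      = (\<Sum>v\<in>verts Q. if v = path_target Q p then single p (a * c) else 0)"
    unfolding path_scalar_def path_mult_sum_right
    by (intro sum.cong refl) (auto simp: path_mult_single path_concat_def)
  then show ?thesis using assms by simp
qed

lemma path_scalar_mult:
  assumes "finite (verts Q)"
  shows "path_mult Q (path_scalar Q c) (path_scalar Q d) = path_scalar Q (c * d)"
proof -
  have "path_mult Q (path_scalar Q c) (path_scalar Q d)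
      = (\<Sum>v\<in>verts Q. path_mult Q (path_scalar Q c) (single (v, []) d))"
    by (simp add: path_scalar_def[of Q d] path_mult_sum_right)
  also have "\<dots> = path_scalar Q (c * d)"
    unfolding path_scalar_def[of Q "c * d"]
    by (intro sum.cong refl path_mult_scalar_left) (use assms in auto)
  finally show ?thesis .
qed

lemma lookup_path_scalar:
  "finite (verts Q) \<Longrightarrow> v \<in> verts Q \<Longrightarrow> lookup (path_scalar Q c) (v, []) = c"
  by (simp add: path_scalar_def lookup_sum lookup_single when_def cong: if_cong)

lemma keys_path_scalar: "keys (path_scalar Q c) \<subseteq> (\<lambda>v. (v, [])) ` verts Q"
  unfolding path_scalar_def by (rule order_trans[OF keys_sum]) auto

section \<open>Paths of a digraph as lists of arrows\<close>

context wf_digraph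
begin

text \<open>The end vertex, existentially quantified in \<open>paths\<close>, is determined by the
  path and equals \<open>path_target\<close>.\<close>

lemma paths_iff:
  "p \<in> paths G \<longleftrightarrow> fst p \<in> verts G \<and> set (snd p) \<subseteq> arcs G \<and> cas (fst p) (snd p) (path_target G p)"
  by (auto simp: paths_def awalk_def path_target_def awlast_if_cas split: prod.splits)

lemma path_target_in_verts: "p \<in> paths G \<Longrightarrow> path_target G p \<in> verts G"
  by (auto simp: paths_iff path_target_def intro: awlast_in_verts)

lemma path_append_iff:
  "(v, xs @ ys) \<in> paths G
    \<longleftrightarrow> (v, xs) \<in> paths G \<and> (path_target G (v, xs), ys) \<in> paths G"
  by (auto simp: paths_def path_target_def awalk_append_iff)

lemma path_concat_in_paths:
  assumes "p \<in> paths G" "q \<in> paths G" "path_target G p = fst q"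
  shows "path_concat p q \<in> paths G"
  using assms path_append_iff[of "fst p" "snd p" "snd q"] by (simp add: path_concat_def)

lemma trivial_path_iff: "(v, []) \<in> paths G \<longleftrightarrow> v \<in> verts G"
  by (auto simp: paths_def awalk_def)

lemma path_Cons_iff:
  "(v, e # es) \<in> paths G \<longleftrightarrow> e \<in> arcs G \<and> v = tail G e \<and> (head G e, es) \<in> paths G"
  by (auto simp: paths_def awalk_Cons_iff)

text \<open>The first arrow forces the start vertex, so paths of positive length may be treated as
  bare lists of composable arrows.\<close>

lemma nonempty_path_iff:
  "es \<noteq> [] \<Longrightarrow> (v, es) \<in> paths G
    \<longleftrightarrow> set es \<subseteq> arcs G \<and> v = tail G (hd es) \<and> successively (\<lambda>a b. head G a = tail G b) es"
proof (induction es arbitrary: v)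
  case (Cons e es)
  then show ?case
    by (cases "es = []") (auto simp: path_Cons_iff trivial_path_iff successively_Cons)
qed simp

end

section \<open>The ring structure of the path algebra\<close>

lemma path_algebra_simps:
  "carrier (path_algebra Q) = {f. keys f \<subseteq> paths Q}"
  "mult (path_algebra Q) = path_mult Q"
  "one (path_algebra Q) = path_scalar Q 1"
  "zero (path_algebra Q) = 0"
  "add (path_algebra Q) = (+)"
  by (simp_all add: path_algebra_def path_scalar_def)

context fin_digraph
begin

lemma path_scalar_in_carrier: "keys (path_scalar G c) \<subseteq> paths G"
  using keys_path_scalar[of G c] by (auto simp: trivial_path_iff)

lemma path_mult_one_left:
  fixes f :: "('a, 'b) path \<Rightarrow>\<^sub>0 'k::field"
  shows "keys f \<subseteq> paths G \<Longrightarrow> path_mult G (path_scalar G 1) f = f"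
  by (induction f rule: poly_mapping_keys_induct)
    (auto simp: path_mult_scalar_left paths_iff path_mult_add_right)

lemma path_mult_one_right:
  fixes f :: "('a, 'b) path \<Rightarrow>\<^sub>0 'k::field"
  shows "keys f \<subseteq> paths G \<Longrightarrow> path_mult G f (path_scalar G 1) = f"
  by (induction f rule: poly_mapping_keys_induct)
    (auto simp: path_mult_scalar_right path_target_in_verts path_mult_add_left)

lemma path_mult_closed:
  assumes "keys f \<subseteq> paths G" "keys g \<subseteq> paths G"
  shows "keys (path_mult G f g) \<subseteq> paths G"
  using keys_path_mult[of G f g] path_concat_in_paths assms by blast

lemma ring_path_algebra: "ring (path_algebra G :: (('a, 'b) path \<Rightarrow>\<^sub>0 'k::field) ring)"
proof (rule ringI)
  show "abelian_group (path_algebra G :: (('a, 'b) path \<Rightarrow>\<^sub>0 'k) ring)"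
  proof (rule abelian_groupI)
    fix f :: "('a, 'b) path \<Rightarrow>\<^sub>0 'k"
    assume "f \<in> carrier (path_algebra G)"
    then show "\<exists>g\<in>carrier (path_algebra G). g \<oplus>\<^bsub>path_algebra G\<^esub> f = \<zero>\<^bsub>path_algebra G\<^esub>"
      by (intro bexI[of _ "- f"]) (auto simp: path_algebra_simps)
  qed (use keys_add in \<open>fastforce simp: path_algebra_simps add_ac\<close>)+
  show "monoid (path_algebra G :: (('a, 'b) path \<Rightarrow>\<^sub>0 'k) ring)"
    by (rule monoidI) (simp_all add: path_algebra_simps path_scalar_in_carrier path_mult_closed
        path_mult_assoc path_mult_one_left path_mult_one_right)
qed (simp_all add: path_algebra_simps path_mult_add_left path_mult_add_right)

end

section \<open>Monomial relations of length two\<close>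

text \<open>The setting for the basis theorem: \<open>R\<close> is any set of paths of length two. A
  vertex provides a trivial path, which keeps the identity of the quotient nonzero.\<close>

locale length_two_relations = fin_digraph G for G :: "('v, 'e) pre_digraph" +
  fixes R :: "('v, 'e) path set"
  assumes relations: "R \<subseteq> {p \<in> paths G. path_length p = 2}"
    and verts_nonempty: "verts G \<noteq> {}"
begin

text \<open>The start vertex of a relation can be ignored: it is the tail of its first arrow.\<close>

definition zero_paths :: "('v, 'e) path set" where
  "zero_paths = {p \<in> paths G. \<exists>r\<in>R. \<exists>us ws. snd p = us @ snd r @ ws}"

text \<open>An explicit description of the ideal generated by \<open>R\<close>, in which membership
  is read off the support; the equality is \<open>genideal_relations\<close>.\<close>

definition zero_ideal :: "(('v, 'e) path \<Rightarrow>\<^sub>0 'k::field) set" where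
  "zero_ideal = {f. keys f \<subseteq> zero_paths}"

lemma zero_paths_subset: "zero_paths \<subseteq> paths G"
  by (auto simp: zero_paths_def)

lemma relations_subset_zero_paths: "R \<subseteq> zero_paths"
proof
  fix r assume "r \<in> R"
  moreover have "snd r = [] @ snd r @ []" by simp
  ultimately show "r \<in> zero_paths" using relations unfolding zero_paths_def by blast
qed

lemma trivial_not_zero: "(v, []) \<notin> zero_paths"
  using relations by (fastforce simp: zero_paths_def)

lemma zero_paths_concat_left:
  assumes "p \<in> paths G" "q \<in> zero_paths" "path_target G p = fst q"
  shows "path_concat p q \<in> zero_paths"
proof -
  obtain r us ws where "r \<in> R" "snd q = us @ snd r @ ws"
    using assms(2) by (auto simp: zero_paths_def)
  then have "snd (path_concat p q) = (snd p @ us) @ snd r @ ws" by (simp add: path_concat_def)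
  then show ?thesis
    using \<open>r \<in> R\<close> assms path_concat_in_paths zero_paths_subset
    unfolding zero_paths_def by blast
qed

lemma zero_paths_concat_right:
  assumes "p \<in> zero_paths" "q \<in> paths G" "path_target G p = fst q"
  shows "path_concat p q \<in> zero_paths"
proof -
  obtain r us ws where "r \<in> R" "snd p = us @ snd r @ ws"
    using assms(1) by (auto simp: zero_paths_def)
  then have "snd (path_concat p q) = us @ snd r @ (ws @ snd q)" by (simp add: path_concat_def)
  then show ?thesis
    using \<open>r \<in> R\<close> assms path_concat_in_paths zero_paths_subset
    unfolding zero_paths_def by blast
qed

lemma a_inv_path_algebra:
  fixes f :: "('v, 'e) path \<Rightarrow>\<^sub>0 'k::field"
  assumes "keys f \<subseteq> paths G"
  shows "\<ominus>\<^bsub>path_algebra G\<^esub> f = - f"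
proof -
  interpret ring "path_algebra G :: (('v, 'e) path \<Rightarrow>\<^sub>0 'k) ring" by (rule ring_path_algebra)
  show ?thesis using assms by (intro minus_equality) (simp_all add: path_algebra_simps)
qed

text \<open>A path that contains a relation still contains it after composition with a path on
  either side.\<close>

lemma ideal_zero_ideal: "ideal (zero_ideal :: (('v, 'e) path \<Rightarrow>\<^sub>0 'k::field) set) (path_algebra G)"
proof (rule idealI)
  interpret ring "path_algebra G :: (('v, 'e) path \<Rightarrow>\<^sub>0 'k) ring" by (rule ring_path_algebra)
  show "ring (path_algebra G :: (('v, 'e) path \<Rightarrow>\<^sub>0 'k) ring)" by (rule ring_axioms)
  show "subgroup (zero_ideal :: (('v, 'e) path \<Rightarrow>\<^sub>0 'k) set) (add_monoid (path_algebra G))"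
  proof (rule add.subgroupI)
    show "zero_ideal \<subseteq> carrier (path_algebra G :: (('v, 'e) path \<Rightarrow>\<^sub>0 'k) ring)"
      using zero_paths_subset by (auto simp: zero_ideal_def path_algebra_simps)
    show "(zero_ideal :: (('v, 'e) path \<Rightarrow>\<^sub>0 'k) set) \<noteq> {}"
      by (auto simp: zero_ideal_def intro!: exI[of _ 0])
    fix f g :: "('v, 'e) path \<Rightarrow>\<^sub>0 'k"
    assume f: "f \<in> zero_ideal"
    then have "keys f \<subseteq> paths G" using zero_paths_subset by (auto simp: zero_ideal_def)
    with f show "\<ominus>\<^bsub>path_algebra G\<^esub> f \<in> zero_ideal"
      by (simp add: a_inv_path_algebra zero_ideal_def)
    assume "g \<in> zero_ideal"
    with f show "f \<oplus>\<^bsub>path_algebra G\<^esub> g \<in> zero_ideal"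
      using keys_add[of f g] by (auto simp: zero_ideal_def path_algebra_simps)
  qed
  fix f g :: "('v, 'e) path \<Rightarrow>\<^sub>0 'k"
  assume f: "f \<in> zero_ideal" and g: "g \<in> carrier (path_algebra G)"
  show "g \<otimes>\<^bsub>path_algebra G\<^esub> f \<in> zero_ideal"
    using f g keys_path_mult[of G g f] zero_paths_concat_left
    unfolding zero_ideal_def path_algebra_simps by blast
  show "f \<otimes>\<^bsub>path_algebra G\<^esub> g \<in> zero_ideal"
    using f g keys_path_mult[of G f g] zero_paths_concat_right
    unfolding zero_ideal_def path_algebra_simps by blast
qed

text \<open>One inclusion is minimality of the generated ideal. For the other, a path containing a
  relation \<open>r\<close> factors as \<open>u\<close>, \<open>r\<close>, \<open>w\<close>, and the
  coefficient is carried by \<open>u\<close>.\<close>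

lemma genideal_relations:
  "Idl\<^bsub>path_algebra G\<^esub> (path_elem ` R) = (zero_ideal :: (('v, 'e) path \<Rightarrow>\<^sub>0 'k::field) set)"
proof
  interpret ring "path_algebra G :: (('v, 'e) path \<Rightarrow>\<^sub>0 'k) ring" by (rule ring_path_algebra)
  let ?I = "Idl\<^bsub>path_algebra G\<^esub> (path_elem ` R) :: (('v, 'e) path \<Rightarrow>\<^sub>0 'k) set"
  show "?I \<subseteq> zero_ideal"
    using relations_subset_zero_paths
    by (intro genideal_minimal ideal_zero_ideal) (auto simp: zero_ideal_def)
  have R_carrier: "path_elem ` R \<subseteq> carrier (path_algebra G :: (('v, 'e) path \<Rightarrow>\<^sub>0 'k) ring)"
    using relations by (auto simp: path_algebra_simps)
  interpret I: ideal ?I "path_algebra G" using R_carrier by (rule genideal_ideal)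
  have single: "single p c \<in> ?I" if p: "p \<in> zero_paths" for p and c :: 'k
  proof -
    obtain r us ws where r: "r \<in> R" "snd p = us @ snd r @ ws"
      using p by (auto simp: zero_paths_def)
    define u where "u = (fst p, us)"
    define w where "w = (path_target G r, ws)"
    have "(fst p, us @ snd r @ ws) \<in> paths G"
      using p zero_paths_subset by (metis r(2) prod.collapse subsetD)
    then have u: "u \<in> paths G" and r': "(path_target G u, snd r) \<in> paths G"
      and w': "(path_target G (path_target G u, snd r), ws) \<in> paths G"
      by (simp_all only: u_def path_append_iff)
    have "r \<in> paths G" "snd r \<noteq> []" using r(1) relations by auto
    \<comment> \<open>Two paths with the same nonempty arrow list start at the same vertex, the tail
      of the first arrow.\<close>
    with r' have ur: "path_target G u = fst r"
      using nonempty_path_iff[of "snd r"] by (metis prod.collapse)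
    then have w: "w \<in> paths G" using w' by (simp add: w_def)
    have "path_elem r \<in> ?I" using genideal_self[OF R_carrier] r(1) by blast
    then have "path_mult G (path_mult G (single u c) (path_elem r)) (path_elem w) \<in> ?I"
      using I.I_l_closed[of "path_elem r" "single u c"] I.I_r_closed[of _ "path_elem w"] u w
      by (simp add: path_algebra_simps)
    also have "path_mult G (path_mult G (single u c) (path_elem r)) (path_elem w)
        = single (path_concat (path_concat u r) w) c"
      using ur by (simp add: path_mult_single path_target_concat w_def)
    also have "path_concat (path_concat u r) w = p"
      using r(2) by (simp add: path_concat_def u_def w_def prod_eq_iff)
    finally show ?thesis .
  qed
  have "f \<in> ?I" if "keys f \<subseteq> zero_paths" for f
    using that
  proof (induction f rule: poly_mapping_keys_induct)
    case zero
    show ?case using I.zero_closed by (simp add: path_algebra_simps)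
  next
    case (add f g)
    then show ?case using I.a_closed by (simp add: path_algebra_simps)
  qed (rule single)
  then show "zero_ideal \<subseteq> ?I" by (auto simp: zero_ideal_def)
qed

section \<open>The quotient algebra and its field of scalars\<close>

definition coset :: "(('v, 'e) path \<Rightarrow>\<^sub>0 'k::field) \<Rightarrow> (('v, 'e) path \<Rightarrow>\<^sub>0 'k) set" where
  "coset f = zero_ideal +>\<^bsub>path_algebra G\<^esub> f"

abbreviation quotient :: "(('v, 'e) path \<Rightarrow>\<^sub>0 'k::field) set ring" where
  "quotient \<equiv> quotient_algebra G zero_ideal"

lemma ring_quotient: "ring (quotient :: (('v, 'e) path \<Rightarrow>\<^sub>0 'k::field) set ring)"
  unfolding quotient_algebra_def by (rule ideal.quotient_is_ring[OF ideal_zero_ideal])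

lemma coset_eq_iff:
  fixes f g :: "('v, 'e) path \<Rightarrow>\<^sub>0 'k::field"
  assumes "keys f \<subseteq> paths G" "keys g \<subseteq> paths G"
  shows "coset f = coset g \<longleftrightarrow> keys (f - g) \<subseteq> zero_paths"
proof -
  interpret ring "path_algebra G :: (('v, 'e) path \<Rightarrow>\<^sub>0 'k) ring" by (rule ring_path_algebra)
  have "f \<ominus>\<^bsub>path_algebra G\<^esub> g = f - g"
    using assms(2) by (simp add: a_minus_def a_inv_path_algebra) (simp add: path_algebra_simps)
  then show ?thesis
    using quotient_eq_iff_same_a_r_cos[OF ideal_zero_ideal, of f g] assms
    by (simp add: coset_def path_algebra_simps zero_ideal_def)
qed

lemma coset_mult:
  fixes f g :: "('v, 'e) path \<Rightarrow>\<^sub>0 'k::field"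
  assumes "keys f \<subseteq> paths G" "keys g \<subseteq> paths G"
  shows "coset f \<otimes>\<^bsub>quotient\<^esub> coset g = coset (path_mult G f g)"
  using ideal.rcoset_mult_add[OF ideal_zero_ideal, of f g] assms
  by (simp add: quotient_algebra_def FactRing_def coset_def path_algebra_simps)

lemma coset_add:
  fixes f g :: "('v, 'e) path \<Rightarrow>\<^sub>0 'k::field"
  assumes "keys f \<subseteq> paths G" "keys g \<subseteq> paths G"
  shows "coset f \<oplus>\<^bsub>quotient\<^esub> coset g = coset (f + g)"
proof -
  interpret ideal "zero_ideal :: (('v, 'e) path \<Rightarrow>\<^sub>0 'k) set" "path_algebra G"
    by (rule ideal_zero_ideal)
  show ?thesis
    using a_rcos_sum[of f g] assms
    by (simp add: quotient_algebra_def FactRing_def coset_def path_algebra_simps)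
qed

lemma coset_zero: "\<zero>\<^bsub>quotient\<^esub> = coset (0 :: ('v, 'e) path \<Rightarrow>\<^sub>0 'k::field)"
proof -
  interpret ideal "zero_ideal :: (('v, 'e) path \<Rightarrow>\<^sub>0 'k) set" "path_algebra G"
    by (rule ideal_zero_ideal)
  show ?thesis
    using a_rcos_const[of 0] by (simp add: quotient_algebra_def FactRing_def coset_def zero_ideal_def)
qed

lemma coset_one: "\<one>\<^bsub>quotient\<^esub> = coset (path_scalar G (1 :: 'k::field))"
  by (simp add: quotient_algebra_def FactRing_def coset_def path_algebra_simps)

lemma coset_in_carrier:
  fixes f :: "('v, 'e) path \<Rightarrow>\<^sub>0 'k::field"
  assumes "keys f \<subseteq> paths G"
  shows "coset f \<in> carrier quotient"
proof -
  interpret ideal "zero_ideal :: (('v, 'e) path \<Rightarrow>\<^sub>0 'k) set" "path_algebra G"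
    by (rule ideal_zero_ideal)
  show ?thesis
    using a_rcosetsI[OF a_subset, of f] assms
    by (simp add: quotient_algebra_def FactRing_def coset_def path_algebra_simps)
qed

lemma scalars_eq: "scalars G zero_ideal = range (\<lambda>c :: 'k::field. coset (path_scalar G c))"
  by (auto simp: scalars_def coset_def path_scalar_def)

lemma path_scalar_add: "path_scalar G c + path_scalar G d = path_scalar G (c + d)"
  by (simp add: path_scalar_def sum.distrib single_add)

lemma path_scalar_zero: "path_scalar G 0 = 0"
  by (simp add: path_scalar_def)

text \<open>A trivial path is never a zero path, so its coefficient is determined by the
  coset.\<close>

lemma coset_path_scalar_inject:
  fixes c d :: "'k::field"
  shows "coset (path_scalar G c) = coset (path_scalar G d) \<longleftrightarrow> c = d"
proof -
  obtain v where v: "v \<in> verts G" using verts_nonempty by blast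
  have "path_scalar G c - path_scalar G d = path_scalar G (c - d)"
    using path_scalar_add[of d "c - d"] by (simp add: algebra_simps)
  then have "lookup (path_scalar G c - path_scalar G d) (v, []) = c - d"
    using v by (simp add: lookup_path_scalar)
  then have "keys (path_scalar G c - path_scalar G d) \<subseteq> zero_paths \<Longrightarrow> c = d"
    using trivial_not_zero[of v] by (metis eq_iff_diff_eq_0 in_keys_iff subsetD)
  then show ?thesis by (auto simp: coset_eq_iff path_scalar_in_carrier)
qed

text \<open>The scalars are the image of the coefficient field under an injective ring homomorphism.
  Being a subfield is what makes the dimension over them unique.\<close>

lemma subfield_scalars: "subfield (scalars G (zero_ideal :: (('v, 'e) path \<Rightarrow>\<^sub>0 'k::field) set)) quotient"
proof -
  interpret ring "quotient :: (('v, 'e) path \<Rightarrow>\<^sub>0 'k) set ring" by (rule ring_quotient)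
  let ?s = "\<lambda>c :: 'k. coset (path_scalar G c)"
  have mult: "?s c \<otimes>\<^bsub>quotient\<^esub> ?s d = ?s (c * d)" for c d
    by (simp add: coset_mult path_scalar_in_carrier path_scalar_mult)
  have add: "?s c \<oplus>\<^bsub>quotient\<^esub> ?s d = ?s (c + d)" for c d
    by (simp add: coset_add path_scalar_in_carrier path_scalar_add)
  have zero: "\<zero>\<^bsub>quotient\<^esub> = ?s 0" by (simp add: coset_zero path_scalar_zero)
  have carrier: "?s c \<in> carrier quotient" for c
    by (simp add: coset_in_carrier path_scalar_in_carrier)
  have inv: "\<ominus>\<^bsub>quotient\<^esub> ?s c = ?s (- c)" for c
    by (rule minus_equality) (simp_all add: add zero carrier)
  show ?thesis
  proof (rule subfieldI)
    show "subcring (scalars G (zero_ideal :: (('v, 'e) path \<Rightarrow>\<^sub>0 'k) set)) quotient"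
      unfolding scalars_eq
      by (intro subcringI subringI) (auto simp: carrier coset_one inv mult add mult.commute)
    show "Units (quotient\<lparr>carrier := scalars G (zero_ideal :: (('v, 'e) path \<Rightarrow>\<^sub>0 'k) set)\<rparr>)
        = scalars G zero_ideal - {\<zero>\<^bsub>quotient\<^esub>}"
    proof (intro equalityI subsetI)
      fix x assume "x \<in> Units (quotient\<lparr>carrier := scalars G (zero_ideal :: (('v, 'e) path \<Rightarrow>\<^sub>0 'k) set)\<rparr>)"
      then obtain c d where "x = ?s c" "?s c \<otimes>\<^bsub>quotient\<^esub> ?s d = ?s 1"
        by (auto simp: Units_def scalars_eq coset_one)
      then show "x \<in> scalars G zero_ideal - {\<zero>\<^bsub>quotient\<^esub>}"
        by (auto simp: scalars_eq mult zero coset_path_scalar_inject)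
    next
      fix x assume "x \<in> scalars G (zero_ideal :: (('v, 'e) path \<Rightarrow>\<^sub>0 'k) set) - {\<zero>\<^bsub>quotient\<^esub>}"
      then obtain c where c: "x = ?s c" "c \<noteq> 0" by (auto simp: scalars_eq zero)
      then have "?s (inverse c) \<otimes>\<^bsub>quotient\<^esub> x = \<one>\<^bsub>quotient\<^esub>" "x \<otimes>\<^bsub>quotient\<^esub> ?s (inverse c) = \<one>\<^bsub>quotient\<^esub>"
        by (simp_all add: mult coset_one)
      then show "x \<in> Units (quotient\<lparr>carrier := scalars G (zero_ideal :: (('v, 'e) path \<Rightarrow>\<^sub>0 'k) set)\<rparr>)"
        using c by (auto simp: Units_def scalars_eq)
    qed
  qed
qed

section \<open>Nonzero paths as a basis of the graded parts\<close>

text \<open>\<open>Span\<close> adjoins one vector at a time. Adjoining the coset of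
  \<open>p\<close> adds a term \<open>single p c\<close>; conversely, the term of \<open>f\<close>
  at \<open>p\<close> is split off, leaving support in the rest of the list.\<close>

lemma Span_cosets:
  assumes "set ps \<subseteq> paths G"
  shows "ring.Span quotient (scalars G zero_ideal) (map (\<lambda>p. coset (path_elem p)) ps)
    = coset ` {f :: ('v, 'e) path \<Rightarrow>\<^sub>0 'k::field. keys f \<subseteq> set ps}"
proof -
  interpret ring "quotient :: (('v, 'e) path \<Rightarrow>\<^sub>0 'k) set ring" by (rule ring_quotient)
  let ?s = "\<lambda>c :: 'k. coset (path_scalar G c)"
  show ?thesis
    using assms
  proof (induction ps)
    case (Cons p ps)
    let ?E = "coset ` {f :: ('v, 'e) path \<Rightarrow>\<^sub>0 'k. keys f \<subseteq> set ps}"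
    have p: "p \<in> paths G" and ps: "set ps \<subseteq> paths G" using Cons.prems by auto
    have combination: "?s c \<otimes>\<^bsub>quotient\<^esub> coset (path_elem p) \<oplus>\<^bsub>quotient\<^esub> coset f = coset (single p c + f)"
      if "keys f \<subseteq> set ps" for c f
    proof -
      have "path_mult G (path_scalar G c) (path_elem p) = single p c"
        using p by (simp add: path_mult_scalar_left paths_iff)
      moreover have "keys f \<subseteq> paths G" using that ps by blast
      ultimately show ?thesis
        using p by (simp add: coset_mult path_scalar_in_carrier coset_add)
    qed
    have "(x \<in> line_extension (scalars G zero_ideal) (coset (path_elem p)) ?E)
      = (x \<in> coset ` {f. keys f \<subseteq> set (p # ps)})" for x
    proof
      assume "x \<in> line_extension (scalars G zero_ideal) (coset (path_elem p)) ?E"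
      then obtain c f where f: "keys f \<subseteq> set ps" and x: "x = coset (single p c + f)"
        by (auto simp: line_extension_mem_iff scalars_eq combination)
      have "keys (single p c + f) \<subseteq> set (p # ps)"
        using keys_add[of "single p c" f] f by (auto split: if_splits)
      with x show "x \<in> coset ` {f. keys f \<subseteq> set (p # ps)}" by blast
    next
      assume "x \<in> coset ` {f. keys f \<subseteq> set (p # ps)}"
      then obtain f where f: "keys f \<subseteq> set (p # ps)" and x: "x = coset f" by blast
      let ?g = "f - single p (lookup f p)"
      have "keys ?g \<subseteq> set ps"
      proof
        fix q assume "q \<in> keys ?g"
        then have "q \<in> keys f" "q \<noteq> p"
          by (auto simp: in_keys_iff lookup_minus lookup_single when_def split: if_splits)
        with f show "q \<in> set ps" by auto
      qed
      moreover have "x = ?s (lookup f p) \<otimes>\<^bsub>quotient\<^esub> coset (path_elem p) \<oplus>\<^bsub>quotient\<^esub> coset ?g"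
        using calculation by (simp add: combination x)
      ultimately show "x \<in> line_extension (scalars G zero_ideal) (coset (path_elem p)) ?E"
        by (auto simp: line_extension_mem_iff scalars_eq)
    qed
    then show ?case using Cons by auto
  qed (simp add: coset_zero)
qed

text \<open>The difference of \<open>p\<close> and a combination of the other paths still has
  \<open>p\<close> in its support. As \<open>p\<close> is not a zero path, this difference lies
  outside the ideal.\<close>

lemma independent_cosets:
  assumes "distinct ps" "set ps \<subseteq> paths G - zero_paths"
  shows "ring.independent quotient (scalars G zero_ideal)
    (map (\<lambda>p. coset (path_elem p :: ('v, 'e) path \<Rightarrow>\<^sub>0 'k::field)) ps)"
proof -
  interpret ring "quotient :: (('v, 'e) path \<Rightarrow>\<^sub>0 'k) set ring" by (rule ring_quotient)
  show ?thesis
    using assms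
  proof (induction ps)
    case (Cons p ps)
    have p: "p \<in> paths G" "p \<notin> zero_paths" "p \<notin> set ps" and ps: "set ps \<subseteq> paths G"
      using Cons.prems by auto
    have "coset (path_elem p) \<noteq> coset f" if f: "keys f \<subseteq> set ps" for f :: "('v, 'e) path \<Rightarrow>\<^sub>0 'k"
    proof -
      have "lookup f p = 0" using f p(3) by (metis in_keys_iff subsetD)
      then have "p \<in> keys (path_elem p - f)" by (simp add: in_keys_iff lookup_minus)
      moreover have "keys f \<subseteq> paths G" using f ps by blast
      ultimately show ?thesis using p by (auto simp: coset_eq_iff)
    qed
    then have "coset (path_elem p :: ('v, 'e) path \<Rightarrow>\<^sub>0 'k) \<notin>
        Span (scalars G zero_ideal) (map (\<lambda>p. coset (path_elem p)) ps)"
      unfolding Span_cosets[OF ps] by blast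
    moreover have "coset (path_elem p :: ('v, 'e) path \<Rightarrow>\<^sub>0 'k) \<in> carrier quotient"
      using p by (simp add: coset_in_carrier)
    ultimately show ?case using Cons by (simp add: li_Cons del: Span.simps)
  qed simp
qed

text \<open>Discarding the terms at zero paths does not change the coset. Staying inside
  \<open>S\<close> preserves the degree when \<open>S\<close> consists of the paths of one
  length.\<close>

lemma coset_reduce:
  fixes f :: "('v, 'e) path \<Rightarrow>\<^sub>0 'k::field"
  assumes "keys f \<subseteq> S" "S \<subseteq> paths G"
  obtains g where "keys g \<subseteq> S - zero_paths" "coset f = coset g"
proof -
  have "\<exists>g. keys g \<subseteq> S - zero_paths \<and> keys (f - g) \<subseteq> zero_paths"
    using assms(1)
  proof (induction f rule: poly_mapping_keys_induct)
    case zero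
    show ?case by (intro exI[of _ 0]) simp
  next
    case (single p c)
    show ?case
    proof (cases "p \<in> zero_paths")
      case True
      then show ?thesis by (intro exI[of _ 0]) simp
    next
      case False
      then show ?thesis using single by (intro exI[of _ "single p c"]) simp
    qed
  next
    case (add f1 f2)
    then obtain g1 g2 where g: "keys g1 \<subseteq> S - zero_paths" "keys (f1 - g1) \<subseteq> zero_paths"
      "keys g2 \<subseteq> S - zero_paths" "keys (f2 - g2) \<subseteq> zero_paths" by blast
    have eq: "f1 + f2 - (g1 + g2) = (f1 - g1) + (f2 - g2)" by (simp add: algebra_simps)
    have "keys (f1 + f2 - (g1 + g2)) \<subseteq> zero_paths"
      unfolding eq using g keys_add[of "f1 - g1" "f2 - g2"] by blast
    moreover have "keys (g1 + g2) \<subseteq> S - zero_paths" using g keys_add[of g1 g2] by blast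
    ultimately show ?case by blast
  qed
  then obtain g where g: "keys g \<subseteq> S - zero_paths" "keys (f - g) \<subseteq> zero_paths" by blast
  then have "coset f = coset g" using assms by (subst coset_eq_iff) auto
  with g that show thesis by blast
qed

definition nonzero_paths :: "nat \<Rightarrow> ('v, 'e) path set" where
  "nonzero_paths n = {p \<in> paths G - zero_paths. path_length p = n}"

lemma finite_nonzero_paths: "finite (nonzero_paths n)"
proof (rule finite_subset)
  show "nonzero_paths n \<subseteq> verts G \<times> {es. set es \<subseteq> arcs G \<and> length es = n}"
    by (auto simp: nonzero_paths_def paths_iff)
qed (simp add: finite_lists_length_eq)

lemma dim_graded_part:
  "ring.dim quotient (scalars G zero_ideal)
    (graded_part G (zero_ideal :: (('v, 'e) path \<Rightarrow>\<^sub>0 'k::field) set) n) = card (nonzero_paths n)"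
proof -
  interpret ring "quotient :: (('v, 'e) path \<Rightarrow>\<^sub>0 'k) set ring" by (rule ring_quotient)
  let ?K = "scalars G (zero_ideal :: (('v, 'e) path \<Rightarrow>\<^sub>0 'k) set)"
  let ?P = "{p \<in> paths G. path_length p = n}"
  obtain ps where ps: "set ps = nonzero_paths n" "distinct ps"
    using finite_distinct_list[OF finite_nonzero_paths] by blast
  let ?Us = "map (\<lambda>p. coset (path_elem p :: ('v, 'e) path \<Rightarrow>\<^sub>0 'k)) ps"
  have "graded_part G (zero_ideal :: (('v, 'e) path \<Rightarrow>\<^sub>0 'k) set) n = coset ` {f. keys f \<subseteq> ?P}"
    by (auto simp: graded_part_def coset_def)
  also have "\<dots> = coset ` {f. keys f \<subseteq> set ps}"
  proof (intro equalityI subsetI)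
    fix x :: "(('v, 'e) path \<Rightarrow>\<^sub>0 'k) set"
    assume "x \<in> coset ` {f. keys f \<subseteq> ?P}"
    then obtain f where f: "keys f \<subseteq> ?P" "x = coset f" by blast
    then obtain g where "keys g \<subseteq> ?P - zero_paths" "coset f = coset g"
      using coset_reduce[of f ?P] by blast
    moreover have "?P - zero_paths = set ps" by (auto simp: ps nonzero_paths_def)
    ultimately show "x \<in> coset ` {f. keys f \<subseteq> set ps}" using f by auto
  next
    fix x :: "(('v, 'e) path \<Rightarrow>\<^sub>0 'k) set"
    assume "x \<in> coset ` {f. keys f \<subseteq> set ps}"
    moreover have "set ps \<subseteq> ?P" by (auto simp: ps nonzero_paths_def)
    ultimately show "x \<in> coset ` {f. keys f \<subseteq> ?P}" by blast
  qed
  also have "\<dots> = Span ?K ?Us"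
    by (rule Span_cosets[symmetric]) (auto simp: ps nonzero_paths_def)
  finally have graded: "graded_part G zero_ideal n = Span ?K ?Us" .
  have "independent ?K ?Us"
    using ps by (intro independent_cosets) (auto simp: nonzero_paths_def)
  then have dimension: "dimension (length ps) ?K (graded_part G zero_ideal n)"
    unfolding graded using dimension_independent by fastforce
  have "dim ?K (graded_part G zero_ideal n) = length ps"
    \<comment> \<open>\<open>dim\<close> is a definite description, so uniqueness of the dimension
      has to be supplied as well.\<close>
    unfolding dim_def
    by (rule the_equality, rule dimension) (rule dimension_is_inj[OF subfield_scalars _ dimension])
  also have "\<dots> = card (nonzero_paths n)" using ps by (metis distinct_card)
  finally show ?thesis .
qed

section \<open>Nonzero paths as chains of arrows\<close>

definition follows :: "'e \<Rightarrow> 'e \<Rightarrow> bool" where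
  "follows a b \<longleftrightarrow> a \<in> arcs G \<and> b \<in> arcs G \<and> head G a = tail G b \<and> (tail G a, [a, b]) \<notin> R"

lemma zero_path_iff:
  "(v, es) \<in> zero_paths \<longleftrightarrow> (v, es) \<in> paths G \<and>
    (\<exists>us a b ws. es = us @ a # b # ws \<and> (tail G a, [a, b]) \<in> R)"
proof
  assume "(v, es) \<in> zero_paths"
  then obtain r us ws where r: "(v, es) \<in> paths G" "r \<in> R" "es = us @ snd r @ ws"
    by (auto simp: zero_paths_def)
  have "r \<in> paths G" "path_length r = 2" using r(2) relations by auto
  then obtain a b where "r = (tail G a, [a, b])"
    by (cases r) (auto simp: numeral_2_eq_2 length_Suc_conv path_Cons_iff)
  with r show "(v, es) \<in> paths G \<and> (\<exists>us a b ws. es = us @ a # b # ws \<and> (tail G a, [a, b]) \<in> R)"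
    by auto
next
  assume "(v, es) \<in> paths G \<and> (\<exists>us a b ws. es = us @ a # b # ws \<and> (tail G a, [a, b]) \<in> R)"
  then obtain us a b ws where "(v, es) \<in> paths G" "es = us @ snd (tail G a, [a, b]) @ ws"
    "(tail G a, [a, b]) \<in> R" by auto
  then show "(v, es) \<in> zero_paths"
    unfolding zero_paths_def by (metis (mono_tags, lifting) mem_Collect_eq snd_conv)
qed

text \<open>Relations have length two, so avoiding them is a condition on adjacent arrows. It merges
  with composability into the single chain condition for \<open>follows\<close>.\<close>

lemma nonzero_path_iff:
  assumes "es \<noteq> []"
  shows "(v, es) \<in> paths G - zero_paths
    \<longleftrightarrow> set es \<subseteq> arcs G \<and> v = tail G (hd es) \<and> successively follows es"
proof -
  have "successively follows es \<longleftrightarrow> successively (\<lambda>a b. head G a = tail G b) es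
      \<and> (\<nexists>us a b ws. es = us @ a # b # ws \<and> (tail G a, [a, b]) \<in> R)" if "set es \<subseteq> arcs G"
  proof -
    have "a \<in> arcs G \<and> b \<in> arcs G" if "es = us @ a # b # ws" for us a b ws
      using \<open>set es \<subseteq> arcs G\<close> that by simp
    then show ?thesis unfolding successively_iff_adjacent follows_def by blast
  qed
  then show ?thesis
    using assms by (auto simp: zero_path_iff nonempty_path_iff)
qed

lemma path_elem_in_zero_ideal:
  "(path_elem p :: ('v, 'e) path \<Rightarrow>\<^sub>0 'k::field) \<in> zero_ideal \<longleftrightarrow> p \<in> zero_paths"
  by (simp add: zero_ideal_def)

text \<open>If \<open>e\<close> is composable with the path, only the new adjacent pair can create a
  relation. Otherwise the product is 0, and \<open>follows\<close> fails too.\<close>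

lemma path_mult_arrow_in_zero_ideal:
  assumes "(v, es) \<in> paths G - zero_paths" "es \<noteq> []" "e \<in> arcs G"
  shows "path_mult G (path_elem (v, es)) (arrow G e) \<in> (zero_ideal :: (('v, 'e) path \<Rightarrow>\<^sub>0 'k::field) set)
    \<longleftrightarrow> \<not> follows (last es) e"
proof (cases "head G (last es) = tail G e")
  case True
  have es: "set es \<subseteq> arcs G" "v = tail G (hd es)" "successively follows es"
    using assms(1) nonzero_path_iff[OF assms(2)] by blast+
  have "(v, es @ [e]) \<in> paths G"
    using assms True by (simp add: path_append_iff path_target_conv path_Cons_iff trivial_path_iff)
  moreover have "(v, es @ [e]) \<in> paths G - zero_paths \<longleftrightarrow> follows (last es) e"
    using assms es by (subst nonzero_path_iff) (simp_all add: successively_append_iff)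
  ultimately show ?thesis
    using True assms by (auto simp: arrow_def path_mult_single path_target_conv path_concat_def
        path_elem_in_zero_ideal)
next
  case False
  then show ?thesis
    using assms by (simp add: arrow_def path_mult_single path_target_conv follows_def zero_ideal_def)
qed

lemma arrow_path_mult_in_zero_ideal:
  assumes "(v, es) \<in> paths G - zero_paths" "es \<noteq> []" "e \<in> arcs G"
  shows "path_mult G (arrow G e) (path_elem (v, es)) \<in> (zero_ideal :: (('v, 'e) path \<Rightarrow>\<^sub>0 'k::field) set)
    \<longleftrightarrow> \<not> follows e (hd es)"
proof -
  have v: "v = tail G (hd es)" using assms by (simp add: nonempty_path_iff)
  show ?thesis
  proof (cases "head G e = v")
    case True
    have es: "set es \<subseteq> arcs G" "successively follows es"
      using assms(1) nonzero_path_iff[OF assms(2)] by blast+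
    have "(tail G e, e # es) \<in> paths G"
      using assms True by (simp add: path_Cons_iff)
    moreover have "(tail G e, e # es) \<in> paths G - zero_paths \<longleftrightarrow> follows e (hd es)"
      using assms es by (subst nonzero_path_iff) (simp_all add: successively_Cons)
    ultimately show ?thesis
      using True assms by (auto simp: arrow_def path_mult_single path_target_conv path_concat_def
          path_elem_in_zero_ideal)
  next
    case False
    then show ?thesis
      using assms v by (simp add: arrow_def path_mult_single path_target_conv follows_def zero_ideal_def)
  qed
qed

lemma card_nonzero_paths_0: "card (nonzero_paths 0) = card (verts G)"
proof -
  have "nonzero_paths 0 = (\<lambda>v. (v, [])) ` verts G"
    by (auto simp: nonzero_paths_def trivial_path_iff trivial_not_zero)
  then show ?thesis by (simp add: card_image inj_on_def)
qed

end

section \<open>Gentle relations\<close>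

text \<open>Conditions (ii) and (iii) of gentleness enter in this form: \<open>follows\<close> is a
  partial injection on the arrows.\<close>

locale gentle_quiver = length_two_relations G R
  for G :: "('v, 'e) pre_digraph" and R :: "('v, 'e) path set" +
  assumes follows_functional: "follows a b \<Longrightarrow> follows a c \<Longrightarrow> b = c"
    and follows_injective: "follows a c \<Longrightarrow> follows b c \<Longrightarrow> a = b"
begin

sublocale finite_partial_injection "arcs G" follows
  by unfold_locales (auto simp: follows_def intro: follows_functional follows_injective)

lemma card_nonzero_paths:
  assumes "n \<ge> 1"
  shows "card (nonzero_paths n) = card (chains n)"
proof -
  have "nonzero_paths n = (\<lambda>es. (tail G (hd es), es)) ` chains n"
  proof (intro equalityI subsetI)
    fix p assume "p \<in> nonzero_paths n"
    then have "p \<in> paths G - zero_paths" and n: "path_length p = n"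
      by (auto simp: nonzero_paths_def)
    moreover have "snd p \<noteq> []" using n assms by auto
    ultimately have "snd p \<in> chains n" "p = (tail G (hd (snd p)), snd p)"
      using nonzero_path_iff[of "snd p" "fst p"] by (simp_all add: chains_def prod_eq_iff)
    then show "p \<in> (\<lambda>es. (tail G (hd es), es)) ` chains n" by blast
  next
    fix p assume "p \<in> (\<lambda>es. (tail G (hd es), es)) ` chains n"
    then obtain es where es: "es \<in> chains n" "p = (tail G (hd es), es)" by blast
    then have "es \<noteq> []" using assms by (auto simp: chains_def)
    then have "p \<in> paths G - zero_paths"
      using es nonzero_path_iff[of es "tail G (hd es)"] by (simp add: chains_def)
    then show "p \<in> nonzero_paths n" using es by (simp add: nonzero_paths_def chains_def)
  qed
  then show ?thesis by (simp add: card_image inj_on_def)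
qed

lemma card_nonzero_paths_1: "card (nonzero_paths 1) = card (arcs G)"
proof -
  have "chains 1 = (\<lambda>e. [e]) ` arcs G"
    by (auto simp: chains_def length_Suc_conv)
  then show ?thesis by (simp add: card_nonzero_paths card_image inj_on_def)
qed

text \<open>Adding the tail of the first arrow as start vertex turns maximal chains into finite
  maximal paths; \<open>n \<ge> 1\<close> ensures that there is a first arrow.\<close>

lemma card_finite_maximal_paths:
  assumes "n \<ge> 1"
  shows "card {p. finite_maximal_path G (zero_ideal :: (('v, 'e) path \<Rightarrow>\<^sub>0 'k::field) set) p
      \<and> path_length p \<ge> n} = card (maximal_chains n)"
proof -
  have maximal: "finite_maximal_path G (zero_ideal :: (('v, 'e) path \<Rightarrow>\<^sub>0 'k) set) (v, es)
    \<longleftrightarrow> v = tail G (hd es) \<and> set es \<subseteq> arcs G \<and> successively follows es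
      \<and> (\<forall>e. \<not> follows (last es) e \<and> \<not> follows e (hd es))"
    if "es \<noteq> []" for v es
  proof -
    have "finite_maximal_path G (zero_ideal :: (('v, 'e) path \<Rightarrow>\<^sub>0 'k) set) (v, es)
      \<longleftrightarrow> (v, es) \<in> paths G - zero_paths
        \<and> (\<forall>e\<in>arcs G. \<not> follows (last es) e \<and> \<not> follows e (hd es))"
      unfolding finite_maximal_path_def path_elem_in_zero_ideal path_algebra_simps
      using that path_mult_arrow_in_zero_ideal[of v es, where 'k = 'k]
        arrow_path_mult_in_zero_ideal[of v es, where 'k = 'k] by blast
    \<comment> \<open>\<open>follows\<close> relates only arrows, so the quantifier may range over
      the whole type, as in \<open>maximal_chains\<close>.\<close>
    also have "\<dots> \<longleftrightarrow> (v, es) \<in> paths G - zero_paths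
        \<and> (\<forall>e. \<not> follows (last es) e \<and> \<not> follows e (hd es))"
      unfolding follows_def by blast
    finally show ?thesis unfolding nonzero_path_iff[OF that] by blast
  qed
  have "{p. finite_maximal_path G (zero_ideal :: (('v, 'e) path \<Rightarrow>\<^sub>0 'k) set) p
      \<and> path_length p \<ge> n} = (\<lambda>es. (tail G (hd es), es)) ` maximal_chains n"
  proof (intro equalityI subsetI)
    fix p :: "('v, 'e) path"
    assume "p \<in> {p. finite_maximal_path G (zero_ideal :: (('v, 'e) path \<Rightarrow>\<^sub>0 'k) set) p
      \<and> path_length p \<ge> n}"
    then have "finite_maximal_path G (zero_ideal :: (('v, 'e) path \<Rightarrow>\<^sub>0 'k) set) (fst p, snd p)"
      and n: "path_length p \<ge> n" by simp_all
    moreover have "snd p \<noteq> []" using n assms by auto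
    ultimately have "snd p \<in> maximal_chains n" "p = (tail G (hd (snd p)), snd p)"
      using maximal[of "snd p" "fst p"] by (simp_all add: maximal_chains_def prod_eq_iff)
    then show "p \<in> (\<lambda>es. (tail G (hd es), es)) ` maximal_chains n" by blast
  next
    fix p :: "('v, 'e) path"
    assume "p \<in> (\<lambda>es. (tail G (hd es), es)) ` maximal_chains n"
    then obtain es where es: "es \<in> maximal_chains n" "p = (tail G (hd es), es)" by blast
    then have "es \<noteq> []" using assms by (auto simp: maximal_chains_def)
    then show "p \<in> {p. finite_maximal_path G (zero_ideal :: (('v, 'e) path \<Rightarrow>\<^sub>0 'k) set) p
      \<and> path_length p \<ge> n}"
      using es maximal[of es "tail G (hd es)"] by (simp add: maximal_chains_def)
  qed
  then show ?thesis by (simp add: card_image inj_on_def)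
qed

text \<open>Multiplication by \<open>1 - fps_X\<close> turns the coefficients into differences of
  consecutive dimensions, and these are given by \<open>card_chains\<close>. The
  \<open>Abs_fps\<close> term is the series with coefficient \<open>k n\<close> at exponent
  \<open>n + 1\<close>, hence 0 below exponent 2.\<close>

lemma hilbert_series_gentle:
  assumes k: "\<And>n. n \<ge> 1 \<Longrightarrow> k n = card {p.
      finite_maximal_path G (zero_ideal :: (('v, 'e) path \<Rightarrow>\<^sub>0 'k::field) set) p \<and> path_length p \<ge> n}"
  shows "hilbert_series G (zero_ideal :: (('v, 'e) path \<Rightarrow>\<^sub>0 'k) set) =
    (fps_const (of_nat (card (verts G)))
      + fps_const (of_nat (card (arcs G)) - of_nat (card (verts G))) * fps_X
      - Abs_fps (\<lambda>m. if m \<ge> 2 then of_nat (k (m - 1)) else 0))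
    / (1 - fps_X)" (is "?h = ?num / _")
proof -
  have h: "fps_nth ?h n = of_nat (card (nonzero_paths n))" for n
    by (simp add: hilbert_series_def dim_graded_part)
  have step: "(of_nat (card (nonzero_paths n)) :: rat)
      = of_nat (card (nonzero_paths (Suc n))) + of_nat (k n)" if "n \<ge> 1" for n
    using that card_chains[of n]
    by (simp add: card_nonzero_paths k card_finite_maximal_paths)
  have "?h * (1 - fps_X) = ?num"
  proof (rule fps_ext)
    fix n
    \<comment> \<open>The first two coefficients come from counting vertices and arrows; every later
      one is \<open>- k (n - 1)\<close>, by \<open>step\<close> at \<open>n - 1\<close>.\<close>
    consider "n = 0" | "n = 1" | m where "n = Suc (Suc m)"
      by (metis One_nat_def not0_implies_Suc)
    then show "fps_nth (?h * (1 - fps_X)) n = fps_nth ?num n"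
    proof cases
      case 1
      then show ?thesis by (simp add: h card_nonzero_paths_0)
    next
      case 2
      then show ?thesis
        using card_nonzero_paths_1 by (simp add: algebra_simps h card_nonzero_paths_0)
    next
      case 3
      then show ?thesis using step[of "Suc m"] by (simp add: algebra_simps h)
    qed
  qed
  moreover have "(1 - fps_X :: rat fps) \<noteq> 0"
  proof
    assume "(1 - fps_X :: rat fps) = 0"
    then have "fps_nth (1 - fps_X :: rat fps) 0 = 0" by simp
    then show False by simp
  qed
  ultimately show ?thesis by (metis nonzero_mult_div_cancel_right)
qed

end

theorem proposition2p13:
  fixes Q :: "('v, 'e) pre_digraph"
    and I :: "(('v, 'e) path \<Rightarrow>\<^sub>0 'k::field_char_0) set"
    and k :: "nat \<Rightarrow> nat"
  assumes "quiver Q"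
    and "gentle Q I \<or> locally_gentle Q I"
    and "\<And>n. n \<ge> 1 \<Longrightarrow> k n = card {p. finite_maximal_path Q I p \<and> path_length p \<ge> n}"
  shows "hilbert_series Q I =
    (fps_const (of_nat (card (verts Q)))
      + fps_const (of_nat (card (arcs Q)) - of_nat (card (verts Q))) * fps_X
      - Abs_fps (\<lambda>m. if m \<ge> 2 then of_nat (k (m - 1)) else 0))
    / (1 - fps_X)"
proof -
  have gentle: "gentle_relations Q I"
    using assms(2) by (auto simp: gentle_def locally_gentle_def)
  then have "\<exists>R \<subseteq> {p \<in> paths Q. path_length p = 2}. I = Idl\<^bsub>path_algebra Q\<^esub> (path_elem ` R)"
    by (simp only: gentle_relations_def)
  then obtain R where R: "R \<subseteq> {p \<in> paths Q. path_length p = 2}"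
    "I = Idl\<^bsub>path_algebra Q\<^esub> (path_elem ` R)" by (elim exE conjE)
  interpret fin_digraph Q using assms(1) by (simp add: quiver_def)
  interpret length_two_relations Q R
    using assms(1) R(1) by unfold_locales (auto simp: quiver_def)
  have I: "I = zero_ideal" using R(2) genideal_relations by simp
  \<comment> \<open>A single arrow is a nonzero path, so the criterion for multiplying a path by an
    arrow applies to \<open>[a]\<close>.\<close>
  have arrow_mult: "arrow Q a \<otimes>\<^bsub>path_algebra Q\<^esub> arrow Q b \<in> I \<longleftrightarrow> \<not> follows a b"
    if "a \<in> arcs Q" "b \<in> arcs Q" for a b
    using that path_mult_arrow_in_zero_ideal[of "tail Q a" "[a]" b, where 'k = 'k]
      nonzero_path_iff[of "[a]" "tail Q a"]
    by (simp add: I path_algebra_simps arrow_def[of Q a])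
  note left = gentle[unfolded gentle_relations_def, THEN conjunct2, THEN conjunct1, rule_format]
    and right = gentle[unfolded gentle_relations_def, THEN conjunct2, THEN conjunct2, THEN conjunct1,
      rule_format]
  interpret gentle_quiver Q R
  proof
    fix a b c
    \<comment> \<open>If \<open>b\<close> and \<open>c\<close> differed, neither product with
      \<open>a\<close> would lie in \<open>I\<close>, whereas \<open>right\<close> puts exactly one
      of them there. Injectivity follows in the same way from \<open>left\<close>.\<close>
    show "b = c" if "follows a b" "follows a c"
    proof (rule ccontr)
      have "a \<in> arcs Q" "b \<in> arcs Q" "c \<in> arcs Q" "head Q a = tail Q b" "head Q a = tail Q c"
        using that by (simp_all add: follows_def)
      moreover assume "b \<noteq> c"
      ultimately show False using right[of a b c] arrow_mult[of a b] arrow_mult[of a c] that by blast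
    qed
    show "a = b" if "follows a c" "follows b c"
    proof (rule ccontr)
      have "a \<in> arcs Q" "b \<in> arcs Q" "c \<in> arcs Q" "tail Q c = head Q a" "tail Q c = head Q b"
        using that by (simp_all add: follows_def)
      moreover assume "a \<noteq> b"
      ultimately show False using left[of c a b] arrow_mult[of a c] arrow_mult[of b c] that by blast
    qed
  qed
  show ?thesis
    unfolding I by (rule hilbert_series_gentle) (use assms(3) I in simp)
qed

end
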